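(* Every induced $P_3$ in a vertex-transitive graph closes to an induced cycle.
   Context: Graphs are finite, simple, undirected, with non-empty vertex set. $P_3$ denotes the three-vertex path. A graph $G$ is vertex-transitive if for any two vertices $u,v\in V(G)$ there is an automorphism of $G$ mapping $u$ to $v$. An induced path in $G$ closes to an induced cycle if there is an induced (chordless) cycle of $G$ that contains the path as a subpath. *)

theory Defs
  imports "Graph_Theory.Graph_Theory"
begin

text \<open>A finite simple undirected graph is a \<^locale>\<open>pair_graph\<close>: the arc relation is symmetric and
  irreflexive, and an undirected edge is a pair of opposite arcs.\<close>

definition graph_automorphism :: "'a pair_pre_digraph \<Rightarrow> ('a \<Rightarrow> 'a) \<Rightarrow> bool" where
  "graph_automorphism G f \<longleftrightarrow>
     bij_betw f (pverts G) (pverts G) \<and>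
     (\<forall>u\<in>pverts G. \<forall>v\<in>pverts G. (f u, f v) \<in> parcs G \<longleftrightarrow> (u, v) \<in> parcs G)"

definition vertex_transitive :: "'a pair_pre_digraph \<Rightarrow> bool" where
  "vertex_transitive G \<longleftrightarrow>
     (\<forall>u\<in>pverts G. \<forall>v\<in>pverts G. \<exists>f. graph_automorphism G f \<and> f u = v)"

text \<open>Paths and cycles are given by the sequence of their vertices, without repetitions; a cycle does
  not repeat its first vertex at the end. \<open>path_graph\<close> and \<open>cycle_graph\<close> turn such a sequence into the
  corresponding graph, with both orientations of each edge; \<open>cycle_graph\<close> adds the edge from the last
  vertex back to the first one.\<close>

definition path_graph :: "'a list \<Rightarrow> 'a pair_pre_digraph" where
  "path_graph p =
     \<lparr> pverts = set p, parcs = set (vwalk_arcs p) \<union> (set (vwalk_arcs p))\<inverse> \<rparr>"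

definition cycle_graph :: "'a list \<Rightarrow> 'a pair_pre_digraph" where
  "cycle_graph c = path_graph (c @ [hd c])"

definition induced_path :: "'a list \<Rightarrow> 'a pair_pre_digraph \<Rightarrow> bool" where
  "induced_path p G \<longleftrightarrow> p \<noteq> [] \<and> distinct p \<and> induced_subgraph (path_graph p) G"

definition induced_cycle :: "'a list \<Rightarrow> 'a pair_pre_digraph \<Rightarrow> bool" where
  "induced_cycle c G \<longleftrightarrow> length c \<ge> 3 \<and> distinct c \<and> induced_subgraph (cycle_graph c) G"

definition closes_to_induced_cycle :: "'a list \<Rightarrow> 'a pair_pre_digraph \<Rightarrow> bool" where
  "closes_to_induced_cycle p G \<longleftrightarrow>
     (\<exists>c. induced_cycle c G \<and> subgraph (path_graph p) (cycle_graph c))"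

end

theory Submission
  imports Defs
begin

text \<open>An induced path \<open>a - b - c\<close> closes to an induced cycle as soon as \<open>a\<close> and \<open>c\<close> are joined by a
  walk whose inner vertices lie outside the closed neighbourhood \<open>N[b]\<close>: a shortest such walk together
  with \<open>b\<close> is an induced cycle. Call \<open>b\<close> avoidable if this holds for all neighbours \<open>a\<close>, \<open>c\<close> of \<open>b\<close>.
  Automorphisms preserve avoidability, so it suffices that every non-empty finite graph has an
  avoidable vertex. Choose a maximal non-empty connected set \<open>C\<close> with \<open>N[C]\<close> not the whole vertex set
  (if there is none, then the graph is complete). By maximality every vertex of \<open>N[C] - C\<close>
  is adjacent to every vertex of \<open>R = V - N[C]\<close>. A vertex \<open>b\<close> that is avoidable in the subgraph
  induced on \<open>R\<close> is avoidable in the whole graph: two neighbours outside \<open>R\<close> are joined through \<open>C\<close>,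
  and a neighbour outside \<open>R\<close> is adjacent to each neighbour inside \<open>R\<close>.\<close>

text \<open>Adjacent or equal \<open>a\<close>, \<open>c\<close> satisfy the condition trivially, so they need not be excluded.\<close>

definition avoidable :: "'a rel \<Rightarrow> 'a set \<Rightarrow> 'a \<Rightarrow> bool" where
  "avoidable E U b \<longleftrightarrow>
     (\<forall>a\<in>U \<inter> E `` {b}. \<forall>c\<in>U \<inter> E `` {b}.
        (a, c) \<in> (Restr E (U - insert b (E `` {b}) \<union> {a, c}))\<^sup>*)"

section \<open>Existence of an avoidable vertex\<close>

lemma rtrancl_Restr_mono:
  assumes "(x, y) \<in> (Restr E A)\<^sup>*" "A \<subseteq> B"
  shows "(x, y) \<in> (Restr E B)\<^sup>*"
  using assms(1) by (rule rev_subsetD) (use assms(2) in \<open>intro rtrancl_mono; blast\<close>)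

lemma connected_insert:
  assumes "sym E" "C \<times> C \<subseteq> (Restr E C)\<^sup>*" "x \<in> C" "(x, s) \<in> E"
  shows "insert s C \<times> insert s C \<subseteq> (Restr E (insert s C))\<^sup>*"
proof -
  let ?R = "(Restr E (insert s C))\<^sup>*"
  have C: "(u, v) \<in> ?R" if "u \<in> C" "v \<in> C" for u v
    using rtrancl_Restr_mono[of u v E C "insert s C"] that assms(2) by blast
  have "(x, s) \<in> ?R" "(s, x) \<in> ?R"
    using assms(1,3,4) by (auto intro!: r_into_rtrancl dest: symD)
  then show ?thesis
    using C assms(3) by (auto intro: rtrancl_trans)
qed

text \<open>The induction shrinks \<open>U\<close> while \<open>E\<close> stays fixed, so that the
  hypothesis for \<open>R\<close> speaks of the subgraph induced on \<open>R\<close>.\<close>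

lemma ex_avoidable:
  assumes "finite U" "U \<noteq> {}" "sym E"
  shows "\<exists>b\<in>U. avoidable E U b"
  using assms(1,2)
proof (induction U rule: finite_psubset_induct)
  case (psubset U)
  define N where "N C = C \<union> E `` C" for C
  define F where "F = {C. C \<noteq> {} \<and> C \<subseteq> U \<and> C \<times> C \<subseteq> (Restr E C)\<^sup>* \<and> \<not> U \<subseteq> N C}"
  show ?case
  proof (cases "F = {}")
    case True
    obtain b where b: "b \<in> U"
      using psubset.prems by blast
    \<comment> \<open>Singletons are connected, so an empty \<open>F\<close> forces
      \<open>N {u}\<close> to cover \<open>U\<close> for every \<open>u\<close> in
      \<open>U\<close>.\<close>
    have "(u, v) \<in> E" if "u \<in> U" "v \<in> U" "u \<noteq> v" for u v
      using True that unfolding F_def N_def by (auto dest!: spec[of _ "{u}"])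
    then have "avoidable E U b"
      unfolding avoidable_def by blast
    with b show ?thesis by blast
  next
    case False
    have "finite F"
      using psubset.hyps by (intro finite_subset[of F "Pow U"]) (auto simp: F_def)
    then obtain C where C: "C \<in> F" and max: "\<And>D. D \<in> F \<Longrightarrow> C \<subseteq> D \<Longrightarrow> D = C"
      using finite_has_maximal[OF _ False] by (metis (no_types))
    define R where "R = U - N C"
    \<comment> \<open>\<open>C\<close> does not dominate \<open>U\<close>, and \<open>R\<close>
      misses the non-empty set \<open>C\<close>.\<close>
    have "R \<noteq> {}" "R \<subset> U"
      using C unfolding R_def F_def N_def by auto
    then obtain b where b: "b \<in> R" and av: "avoidable E R b"
      using psubset.IH by blast
    \<comment> \<open>If \<open>s\<close> missed \<open>r\<close>, then \<open>insert s C\<close>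
      would be connected with \<open>r\<close> still outside its closed neighbourhood, against the
      maximality of \<open>C\<close>.\<close>
    have complete: "(s, r) \<in> E" if "s \<in> U" "s \<in> N C" "s \<notin> C" "r \<in> R" for s r
    proof (rule ccontr)
      assume "(s, r) \<notin> E"
      moreover obtain x where "x \<in> C" "(x, s) \<in> E"
        using \<open>s \<in> N C\<close> \<open>s \<notin> C\<close> by (auto simp: N_def)
      ultimately have "insert s C \<in> F"
        using C connected_insert[OF assms(3), of C x s] that
        unfolding F_def N_def R_def by auto
      with max \<open>s \<notin> C\<close> show False by blast
    qed
    have sym: "(y, x) \<in> E" if "(x, y) \<in> E" for x y
      using that assms(3) by (rule symD[rotated])
    have CU: "C \<subseteq> U - insert b (E `` {b})"
      using C b sym unfolding F_def R_def N_def by blast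
    have "(a, c) \<in> (Restr E (U - insert b (E `` {b}) \<union> {a, c}))\<^sup>*" (is "_ \<in> (Restr E ?A)\<^sup>*")
      if a: "a \<in> U \<inter> E `` {b}" and c: "c \<in> U \<inter> E `` {b}" for a c
    proof -
      have notC: "a \<notin> C" "c \<notin> C"
        using a c CU by auto
      \<comment> \<open>If exactly one of \<open>a\<close>, \<open>c\<close> lies in
        \<open>R\<close>, then \<open>complete\<close> makes them adjacent.\<close>
      consider "a \<in> R" "c \<in> R" | "(a, c) \<in> E" | "a \<in> N C" "c \<in> N C"
        using complete sym a c notC unfolding R_def by blast
      then show ?thesis
      proof cases
        case 1
        then have "(a, c) \<in> (Restr E (R - insert b (E `` {b}) \<union> {a, c}))\<^sup>*"
          using av a c unfolding avoidable_def by blast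
        then show ?thesis
          by (rule rtrancl_Restr_mono) (auto simp: R_def)
      next
        case 2
        then show ?thesis by blast
      next
        case 3
        then obtain x y where xy: "x \<in> C" "y \<in> C" "(x, a) \<in> E" "(y, c) \<in> E"
          using notC by (auto simp: N_def)
        then have "(x, y) \<in> (Restr E C)\<^sup>*"
          using C unfolding F_def by blast
        then have "(x, y) \<in> (Restr E ?A)\<^sup>*"
          by (rule rtrancl_Restr_mono) (use CU in blast)
        moreover have "(a, x) \<in> (Restr E ?A)\<^sup>*" "(y, c) \<in> (Restr E ?A)\<^sup>*"
          using xy CU sym by (blast intro: r_into_rtrancl)+
        ultimately show ?thesis by (meson rtrancl_trans)
      qed
    qed
    then have "avoidable E U b"
      unfolding avoidable_def by blast
    with b show ?thesis unfolding R_def by blast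
  qed
qed

section \<open>Walks as vertex lists and shortest walks\<close>

lemma set_vwalk_arcs_nth: "set (vwalk_arcs q) = {(q ! i, q ! Suc i) | i. Suc i < length q}"
proof (induction q rule: vwalk_arcs.induct)
  case (3 x y zs)
  have "{((x # y # zs) ! i, (x # y # zs) ! Suc i) | i. Suc i < length (x # y # zs)} =
    insert (x, y) {((y # zs) ! i, (y # zs) ! Suc i) | i. Suc i < length (y # zs)}"
    (is "?L = ?R")
  proof (intro equalityI subsetI)
    fix e assume "e \<in> ?L"
    then obtain i where "e = ((x # y # zs) ! i, (x # y # zs) ! Suc i)" "Suc i < length (x # y # zs)"
      by blast
    then show "e \<in> ?R" by (cases i) auto
  next
    fix e assume "e \<in> ?R"
    then show "e \<in> ?L"
      by (elim insertE CollectE exE conjE) (force intro: exI[of _ 0] exI[of _ "Suc _"])+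
  qed
  with 3 show ?case by simp
qed auto

lemma vwalk_arcs_append:
  "xs \<noteq> [] \<Longrightarrow> ys \<noteq> [] \<Longrightarrow>
    set (vwalk_arcs (xs @ ys)) = set (vwalk_arcs xs) \<union> {(last xs, hd ys)} \<union> set (vwalk_arcs ys)"
proof (induction xs rule: vwalk_arcs.induct)
  case (2 x)
  then show ?case by (cases ys) auto
qed auto

lemma rtrancl_walk:
  assumes "(a, c) \<in> r\<^sup>*"
  obtains q where "q \<noteq> []" "hd q = a" "last q = c" "successively (\<lambda>x y. (x, y) \<in> r) q"
proof -
  from assms have "\<exists>q. q \<noteq> [] \<and> hd q = a \<and> last q = c \<and> successively (\<lambda>x y. (x, y) \<in> r) q"
  proof (induction rule: converse_rtrancl_induct)
    case base
    show ?case by (rule exI[of _ "[c]"]) simp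
  next
    case (step x y)
    then obtain q where "q \<noteq> []" "hd q = y" "last q = c" "successively (\<lambda>x y. (x, y) \<in> r) q"
      by blast
    with step.hyps(1) show ?case
      by (intro exI[of _ "x # q"]) (auto simp: successively_Cons)
  qed
  with that show thesis by blast
qed

text \<open>A shortest walk will do: a forward chord or a repeated vertex would give a shorter walk
  with the same ends.\<close>

lemma rtrancl_induced_walk:
  assumes "(a, c) \<in> r\<^sup>*" "irrefl r"
  obtains q where "q \<noteq> []" "hd q = a" "last q = c" "set (vwalk_arcs q) \<subseteq> r" "distinct q"
    "\<And>i j. i < j \<Longrightarrow> j < length q \<Longrightarrow> (q ! i, q ! j) \<in> r \<Longrightarrow> j = Suc i"
proof -
  define P where "P q \<longleftrightarrow> q \<noteq> [] \<and> hd q = a \<and> last q = c \<and> successively (\<lambda>x y. (x, y) \<in> r) q" for q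
  obtain q0 where "P q0"
    using rtrancl_walk[OF assms(1)] unfolding P_def by blast
  then obtain q where q: "P q" and min: "\<And>q'. P q' \<Longrightarrow> length q \<le> length q'"
    using ex_has_least_nat[of P q0 length] by blast
  have arcs: "set (vwalk_arcs q) \<subseteq> r"
    using q unfolding P_def by (auto simp: set_vwalk_arcs_nth successively_conv_nth)
  have no_short: "j = Suc i" if ij: "i < j" "j < length q" and e: "(q ! i, q ! j) \<in> r" for i j
  proof (rule ccontr)
    assume "j \<noteq> Suc i"
    \<comment> \<open>The arc from \<open>q ! i\<close> to \<open>q ! j\<close> bypasses the
      positions strictly between \<open>i\<close> and \<open>j\<close>; there is at least one of
      them.\<close>
    let ?q = "take (Suc i) q @ drop j q"
    have s: "successively (\<lambda>x y. (x, y) \<in> r) (take k q)"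
      "successively (\<lambda>x y. (x, y) \<in> r) (drop k q)" for k
      using q unfolding P_def by (metis append_take_drop_id successively_append_iff)+
    have "last (take (Suc i) q) = q ! i" "hd (drop j q) = q ! j"
      using ij by (simp_all add: take_Suc_conv_app_nth hd_drop_conv_nth)
    then have "P ?q"
      using q s ij e unfolding P_def by (auto simp: successively_append_iff)
    from min[OF this] ij \<open>j \<noteq> Suc i\<close> show False by simp
  qed
  have "distinct q"
  proof -
    have "q ! i \<noteq> q ! j" if ij: "i < j" "j < length q" for i j
    proof
      assume eq: "q ! i = q ! j"
      show False
      \<comment> \<open>If the first vertex recurs at \<open>j\<close>, the walk can start there.
        Otherwise the predecessor \<open>q ! k\<close> of \<open>q ! i\<close> also has an arc to
        \<open>q ! j\<close>, and \<open>no_short\<close> would give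
        \<open>j = Suc k = i\<close>.\<close>
      proof (cases "i = 0")
        case True
        have "P (drop j q)"
          using q ij eq True unfolding P_def
          by (auto simp: hd_drop_conv_nth hd_conv_nth)
             (metis append_take_drop_id successively_append_iff)
        from min[OF this] ij show False by simp
      next
        case False
        then obtain k where k: "i = Suc k" by (cases i) auto
        have "(q ! k, q ! i) \<in> r"
          using arcs ij k by (metis (mono_tags, lifting) CollectI Suc_lessD less_trans_Suc set_vwalk_arcs_nth subsetD)
        with eq no_short[of k j] ij k show False by simp
      qed
    qed
    then show ?thesis
      by (metis distinct_conv_nth linorder_neqE_nat)
  qed
  then show thesis
    using that q arcs no_short unfolding P_def by blast
qed

section \<open>Closing an induced path to an induced cycle\<close>

lemma wf_path_graph: "wf_digraph (path_graph p)"
  by (auto simp: wf_digraph_def path_graph_def set_vwalk_arcs_nth)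

text \<open>Separates the edges at \<open>b\<close> from those of the walk \<open>q\<close>,
  matching the later case split on possible chords.\<close>

lemma parcs_cycle_graph_Cons:
  assumes "q \<noteq> []"
  shows "parcs (cycle_graph (b # q)) =
    (let A = {(b, hd q), (last q, b)} \<union> set (vwalk_arcs q) in A \<union> A\<inverse>)"
proof -
  have "set (vwalk_arcs (b # q @ [b])) = {(b, hd q), (last q, b)} \<union> set (vwalk_arcs q)"
    using vwalk_arcs_append[of "[b]" "q @ [b]"] vwalk_arcs_append[of q "[b]"] assms by auto
  then show ?thesis
    by (simp add: cycle_graph_def path_graph_def)
qed

lemma pverts_cycle_graph: "c \<noteq> [] \<Longrightarrow> pverts (cycle_graph c) = set c"
  by (auto simp: cycle_graph_def path_graph_def)

lemma closes_to_induced_cycleI: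
  fixes G :: "'a pair_pre_digraph"
  defines "E \<equiv> parcs G"
  assumes "pair_graph G" and ind: "induced_path [a, b, c] G"
    and conn: "(a, c) \<in> (Restr E (pverts G - insert b (E `` {b}) \<union> {a, c}))\<^sup>*"
  shows "closes_to_induced_cycle [a, b, c] G"
proof -
  interpret pair_graph G by fact
  define W where "W = pverts G - insert b (E `` {b}) \<union> {a, c}"
  have sym: "(v, u) \<in> E" if "(u, v) \<in> E" for u v
    using that pair_sym_arcs by (auto simp: E_def symmetric_def dest: symD)
  have irr: "(u, u) \<notin> E" for u
    using pair_no_loops unfolding E_def by fastforce
  have abc: "a \<noteq> c" "b \<noteq> a" "b \<noteq> c" "a \<in> pverts G" "b \<in> pverts G" "c \<in> pverts G"
    "(b, a) \<in> E" "(b, c) \<in> E"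
    using ind unfolding induced_path_def induced_subgraph_def subgraph_def path_graph_def E_def
    by auto
  have "irrefl (Restr E W)"
    using irr by (auto simp: irrefl_def)
  with conn obtain q where q: "q \<noteq> []" "hd q = a" "last q = c" "distinct q"
    and arcs: "set (vwalk_arcs q) \<subseteq> Restr E W"
    and chordless: "\<And>i j. i < j \<Longrightarrow> j < length q \<Longrightarrow> (q ! i, q ! j) \<in> Restr E W \<Longrightarrow> j = Suc i"
    unfolding W_def by (rule rtrancl_induced_walk) blast
  have qW: "set q \<subseteq> W"
  proof
    fix x assume "x \<in> set q"
    then obtain i where i: "i < length q" "x = q ! i"
      by (auto simp: in_set_conv_nth)
    show "x \<in> W"
    \<comment> \<open>Each vertex after the first is the head of an arc in \<open>Restr E W\<close>;
      the first one is \<open>a\<close>.\<close>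
    proof (cases i)
      case 0
      then show ?thesis using q i by (simp add: W_def hd_conv_nth)
    next
      case (Suc k)
      then have "(q ! k, x) \<in> set (vwalk_arcs q)"
        using i by (auto simp: set_vwalk_arcs_nth)
      then show ?thesis using arcs by blast
    qed
  qed
  have aq: "a \<in> set q" "c \<in> set q"
    using q by auto
  let ?C = "cycle_graph (b # q)"
  have pv: "pverts ?C = insert b (set q)"
    by (simp add: pverts_cycle_graph)
  have pa: "parcs ?C = (let A = {(b, a), (c, b)} \<union> set (vwalk_arcs q) in A \<union> A\<inverse>)"
    using q by (simp add: parcs_cycle_graph_Cons)
  have bq: "b \<notin> set q"
    using qW abc by (auto simp: W_def)
  \<comment> \<open>No chord starts at \<open>b\<close>, because \<open>W\<close> contains no
    neighbours of \<open>b\<close> other than \<open>a\<close> and \<open>c\<close>.\<close>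
  have adj_b: "v \<in> {a, c}" if "(b, v) \<in> E" "v \<in> insert b (set q)" for v
    using that irr qW unfolding W_def by blast
  have adj_q: "(q ! i, q ! j) \<in> set (vwalk_arcs q)"
    if "i < j" "j < length q" "(q ! i, q ! j) \<in> E" for i j
  proof -
    have "(q ! i, q ! j) \<in> Restr E W"
      using that qW by auto
    then have "j = Suc i"
      using chordless that by blast
    with that show ?thesis by (auto simp: set_vwalk_arcs_nth)
  qed
  have "parcs ?C = {(u, v) \<in> E. u \<in> pverts ?C \<and> v \<in> pverts ?C}"
  proof (intro equalityI subsetI)
    fix e assume "e \<in> parcs ?C"
    moreover have "set (vwalk_arcs q) \<subseteq> set q \<times> set q"
      by (auto simp: set_vwalk_arcs_nth)
    ultimately show "e \<in> {(u, v) \<in> E. u \<in> pverts ?C \<and> v \<in> pverts ?C}"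
      using abc sym arcs aq unfolding pa pv Let_def by blast
  next
    fix e assume "e \<in> {(u, v) \<in> E. u \<in> pverts ?C \<and> v \<in> pverts ?C}"
    then obtain u v where e: "e = (u, v)" and E: "(u, v) \<in> E"
      and uv: "u \<in> insert b (set q)" "v \<in> insert b (set q)"
      unfolding pv by blast
    consider "u = b" | "v = b" | "u \<in> set q" "v \<in> set q"
      using uv by blast
    then show "e \<in> parcs ?C"
    proof cases
      case 1
      then show ?thesis using adj_b E uv unfolding e pa Let_def by blast
    next
      case 2
      then show ?thesis using adj_b sym[OF E] uv unfolding e pa Let_def by blast
    next
      case 3
      then obtain i j where ij: "u = q ! i" "v = q ! j" "i < length q" "j < length q"
        by (auto simp: in_set_conv_nth)
      \<comment> \<open>Equal positions would give a loop; for \<open>j < i\<close> the reversed arc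
        is the one on the walk.\<close>
      then have "i < j \<or> j < i"
        using E irr by (metis linorder_neqE_nat)
      then have "(u, v) \<in> set (vwalk_arcs q) \<or> (v, u) \<in> set (vwalk_arcs q)"
        using adj_q E sym[OF E] ij by blast
      then show ?thesis unfolding e pa Let_def by blast
    qed
  qed
  moreover have "pverts ?C \<subseteq> pverts G"
    using qW abc unfolding pv W_def by blast
  moreover have wf: "wf_digraph ?C"
    unfolding cycle_graph_def by (rule wf_path_graph)
  ultimately have "induced_subgraph ?C G"
    unfolding induced_subgraph_def subgraph_def compatible_def
    using wf_digraph by (auto simp: E_def)
  \<comment> \<open>The distinct vertices \<open>a\<close> and \<open>c\<close> both lie on
    \<open>q\<close>.\<close>
  moreover have "length (b # q) \<ge> 3"
  proof -
    have "card {a, c} \<le> card (set q)"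
      using aq by (intro card_mono) auto
    then show ?thesis using abc q by (simp add: distinct_card)
  qed
  ultimately have "induced_cycle (b # q) G"
    using q bq by (simp add: induced_cycle_def)
  moreover have "subgraph (path_graph [a, b, c]) ?C"
    unfolding subgraph_def compatible_def
    using wf wf_path_graph[of "[a, b, c]"] aq by (auto simp: pv pa path_graph_def)
  ultimately show ?thesis
    unfolding closes_to_induced_cycle_def by blast
qed

section \<open>Transport of avoidability along automorphisms\<close>

lemma rtrancl_image:
  assumes "(a, c) \<in> r\<^sup>*" "\<And>x y. (x, y) \<in> r \<Longrightarrow> (g x, g y) \<in> s"
  shows "(g a, g c) \<in> s\<^sup>*"
  using assms(1)
proof (induction rule: rtrancl_induct)
  case (step y z)
  from step.IH assms(2)[OF step.hyps(2)] show ?case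
    by (rule rtrancl_into_rtrancl)
qed simp

text \<open>A walk witnessing avoidability of \<open>f b\<close> is pulled back along the inverse of
  \<open>f\<close>, which preserves adjacency and non-adjacency.\<close>

lemma avoidable_automorphism:
  assumes "graph_automorphism G f" "b \<in> pverts G"
    and av: "avoidable (parcs G) (pverts G) (f b)"
  shows "avoidable (parcs G) (pverts G) b"
proof -
  let ?V = "pverts G" and ?E = "parcs G"
  have bij: "bij_betw f ?V ?V"
    and f: "\<And>u v. u \<in> ?V \<Longrightarrow> v \<in> ?V \<Longrightarrow> (f u, f v) \<in> ?E \<longleftrightarrow> (u, v) \<in> ?E"
    using assms(1) by (auto simp: graph_automorphism_def)
  define g where "g = the_inv_into ?V f"
  have g: "g x \<in> ?V" "f (g x) = x" if "x \<in> ?V" for x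
    using that bij unfolding g_def
    by (auto simp: bij_betw_def the_inv_into_into f_the_inv_into_f)
  have gf: "g (f x) = x" if "x \<in> ?V" for x
    using that bij unfolding g_def by (auto simp: bij_betw_def the_inv_into_f_f)
  have fV: "f x \<in> ?V" if "x \<in> ?V" for x
    using that bij by (auto simp: bij_betw_def)
  have "(a, c) \<in> (Restr ?E (?V - insert b (?E `` {b}) \<union> {a, c}))\<^sup>*" (is "_ \<in> (Restr _ ?A)\<^sup>*")
    if a: "a \<in> ?V \<inter> ?E `` {b}" and c: "c \<in> ?V \<inter> ?E `` {b}" for a c
  proof -
    let ?B = "?V - insert (f b) (?E `` {f b}) \<union> {f a, f c}"
    have "(f a, f c) \<in> (Restr ?E ?B)\<^sup>*"
      using av a c f assms(2) fV unfolding avoidable_def by blast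
    moreover have "(g x, g y) \<in> Restr ?E ?A" if xy: "(x, y) \<in> Restr ?E ?B" for x y
    proof -
      have "z \<in> ?V \<and> g z \<in> ?A" if "z \<in> ?B" for z
      \<comment> \<open>The ends are treated apart, being themselves neighbours of
        \<open>f b\<close>.\<close>
      proof (cases "z \<in> {f a, f c}")
        case True
        then show ?thesis using a c fV gf by auto
      next
        case False
        then have z: "z \<in> ?V" "z \<noteq> f b" "(f b, z) \<notin> ?E"
          using that by auto
        then have "g z \<noteq> b" "(b, g z) \<notin> ?E"
          using g[of z] f[of b "g z"] assms(2) by auto
        with z g show ?thesis by blast
      qed
      moreover have "(g x, g y) \<in> ?E" if "x \<in> ?V" "y \<in> ?V"
        using that xy f[of "g x" "g y"] g by auto
      ultimately show ?thesis using xy by blast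
    qed
    ultimately have "(g (f a), g (f c)) \<in> (Restr ?E ?A)\<^sup>*"
      by (rule rtrancl_image)
    then show ?thesis using gf a c by auto
  qed
  then show ?thesis
    unfolding avoidable_def by blast
qed

theorem corollary7p1:
  fixes G :: "'a pair_pre_digraph" and p :: "'a list"
  assumes "pair_graph G" and "pverts G \<noteq> {}"
    and "vertex_transitive G"
    and "induced_path p G" and "length p = 3"
  shows "closes_to_induced_cycle p G"
proof -
  interpret pair_graph G by fact
  let ?V = "pverts G" and ?E = "parcs G"
  obtain a b c where p: "p = [a, b, c]"
    using assms(5) by (auto simp: length_Suc_conv numeral_3_eq_3)
  have abc: "a \<in> ?V" "b \<in> ?V" "c \<in> ?V" "(b, a) \<in> ?E" "(b, c) \<in> ?E"
    using assms(4) unfolding p induced_path_def induced_subgraph_def subgraph_def path_graph_def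
    by auto
  have "sym ?E"
    using pair_sym_arcs by (simp add: symmetric_def)
  then obtain b' where "b' \<in> ?V" "avoidable ?E ?V b'"
    using ex_avoidable[OF pair_finite_verts assms(2)] by blast
  \<comment> \<open>The automorphism maps \<open>b\<close> to \<open>b'\<close>, since avoidability
    is pulled back from the image to \<open>b\<close>.\<close>
  moreover from this obtain f where "graph_automorphism G f" "f b = b'"
    using assms(3) abc(2) unfolding vertex_transitive_def by blast
  ultimately have "avoidable ?E ?V b"
    using avoidable_automorphism[of G f b] abc(2) by simp
  then show ?thesis
    using abc closes_to_induced_cycleI[OF assms(1)] assms(4) unfolding p avoidable_def by blast
qed

end
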